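(* Let $N\ge1$ be an integer, let $B,R>0$, and define $H:(0,\infty)\to\mathbb{R}$ by $$H(h)=\begin{cases}1-Nh&\text{if } h\le \frac{1}{s_{N+1}^2},\\[2mm] \left(\tfrac12 s_{N+1}^2-N\right)h+\frac{1}{2s_{N+1}^2h}&\text{if } h>\frac{1}{s_{N+1}^2}.\end{cases}$$ The value of $h$ that minimizes $H$ (equivalently, the last-iterate rate $BR\,H(h)$ of the projected subgradient method with constant step size $h\frac RB$) over $(0,\infty)$ is $$h^\star=\frac{1}{s_{N+1}\sqrt{s_{N+1}^2-2N}}.$$ Moreover, let $X\subseteq\mathbb{R}^n$ be a nonempty closed convex set, and let $f$ be a convex function whose domain contains $X$, with $\partial f(x)\ne\emptyset$ for every $x\in X$ and with $B$-bounded subgradients on $X$. Let $x^*$ be a minimizer of $f$ over $X$ and let $x^1\in X$ satisfy $\|x^1-x^*\|\le R$. If $x^2,\dots,x^{N+1}$ are generated by $x^{k+1}=P_X\left(x^k-h^\star\tfrac{R}{B}g^k\right)$ with $g^k\in\partial f(x^k)$, $k=1,\dots,N$, then $$f(x^{N+1})-f(x^* )\le BR\sqrt{1-\frac{2N}{s_{N+1}^2}}.$$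
   Context: $\|\cdot\|$ is the Euclidean norm and $P_X$ is the Euclidean projection onto $X$. The subdifferential is $\partial f(x)=\{g\in\mathbb{R}^n : f(y)\ge f(x)+\langle g,y-x\rangle \text{ for all } y\in\mathrm{dom} f\}$. The function $f$ has $B$-bounded subgradients on $X$ if $\|g\|\le B$ for all $x\in X$ and $g\in\partial f(x)$. The real sequence $(s_k)_{k\ge1}$ is defined by $s_1=1$ and $s_{k+1}=s_k+\frac{1}{s_k}$. *)

theory Defs
  imports "HOL-Analysis.Analysis"
begin

text \<open>The sequence starts at index 1; the value at index 0 is an unused placeholder.\<close>

fun s_seq :: "nat \<Rightarrow> real" where
  "s_seq 0 = 0"
| "s_seq (Suc 0) = 1"
| "s_seq (Suc (Suc k)) = s_seq (Suc k) + 1 / s_seq (Suc k)"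

text \<open>Only the values at positive arguments are meaningful.\<close>

definition rate_H :: "nat \<Rightarrow> real \<Rightarrow> real" where
  "rate_H N h =
     (if h \<le> 1 / (s_seq (N + 1))\<^sup>2 then 1 - real N * h
      else ((s_seq (N + 1))\<^sup>2 / 2 - real N) * h + 1 / (2 * (s_seq (N + 1))\<^sup>2 * h))"

definition h_star :: "nat \<Rightarrow> real" where
  "h_star N = 1 / (s_seq (N + 1) * sqrt ((s_seq (N + 1))\<^sup>2 - 2 * real N))"

text \<open>An extended-valued convex function is represented by its effective domain \<open>D\<close> together
  with a real-valued function \<open>f\<close> whose values outside \<open>D\<close> are irrelevant. The subdifferential
  depends on \<open>D\<close>, and is empty at points outside \<open>D\<close>, where the represented function is infinite.\<close>

definition subdifferential ::
  "(real^'n) set \<Rightarrow> (real^'n \<Rightarrow> real) \<Rightarrow> real^'n \<Rightarrow> (real^'n) set" where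
  "subdifferential D f x = {g. x \<in> D \<and> (\<forall>y\<in>D. f y \<ge> f x + g \<bullet> (y - x))}"

definition bounded_subgradients ::
  "(real^'n) set \<Rightarrow> (real^'n \<Rightarrow> real) \<Rightarrow> real \<Rightarrow> (real^'n) set \<Rightarrow> bool" where
  "bounded_subgradients D f B X \<longleftrightarrow> (\<forall>x\<in>X. \<forall>g\<in>subdifferential D f x. norm g \<le> B)"

end

theory Submission
  imports Defs
begin

text \<open>For \<open>n\<close> remaining steps of size \<open>h\<close> and any comparison point \<open>z\<close> one shows
  \<open>2h (f (x\<^sup>n\<^sup>+\<^sup>1) - f z) \<le> \<parallel>x\<^sup>1 - z\<parallel>\<^sup>2 / s\<^sub>n\<^sub>+\<^sub>1\<^sup>2 + h\<^sup>2 B\<^sup>2 (s\<^sub>n\<^sub>+\<^sub>1\<^sup>2 - 2n)\<close>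
  by induction on \<open>n\<close>. The comparison point moves along: after the first step it is
  replaced by a convex combination of \<open>z\<close> and \<open>x\<^sup>1\<close>, whose weights are chosen so that
  the terms in \<open>f (x\<^sup>1)\<close> cancel; this choice forces the recursion \<open>s + 1 / s\<close>. The optimal
  step size balances the two terms on the right.\<close>

lemma s_seq_Suc_pos: "s_seq (Suc n) > 0"
  by (induction n) (auto intro: add_pos_pos)

lemma s_seq_Suc_Suc_sq:
  "(s_seq (Suc (Suc n)))\<^sup>2 = (s_seq (Suc n))\<^sup>2 + 2 + 1 / (s_seq (Suc n))\<^sup>2"
  using s_seq_Suc_pos[of n] by (simp add: power2_eq_square field_simps)

text \<open>Squaring the recursion adds at least 2 per step. Hence the radicand in
  \<open>h_star\<close> is at least 1, and the coefficient of \<open>h\<close> in the second branch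
  of \<open>rate_H\<close> is positive.\<close>

lemma s_seq_sq_lower: "(s_seq (Suc n))\<^sup>2 \<ge> 2 * real n + 1"
proof (induction n)
  case (Suc n)
  define t where "t = 1 / (s_seq (Suc n))\<^sup>2"
  have "t \<ge> 0" by (simp add: t_def)
  then show ?case
    using Suc unfolding s_seq_Suc_Suc_sq t_def[symmetric] by simp
qed simp

lemma sqrt_rate_eq:
  "sqrt (1 - 2 * real N / (s_seq (Suc N))\<^sup>2)
    = sqrt ((s_seq (Suc N))\<^sup>2 - 2 * real N) / s_seq (Suc N)"
proof -
  have "1 - 2 * real N / (s_seq (Suc N))\<^sup>2
      = ((s_seq (Suc N))\<^sup>2 - 2 * real N) / (s_seq (Suc N))\<^sup>2"
    using s_seq_Suc_pos[of N] by (simp add: field_simps)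
  then show ?thesis
    using s_seq_Suc_pos[of N] by (simp add: real_sqrt_divide)
qed

lemma h_star_pos: "h_star N > 0"
  using s_seq_Suc_pos[of N] s_seq_sq_lower[of N] by (simp add: h_star_def)

text \<open>For \<open>N \<ge> 1\<close> the root in \<open>h_star\<close> is strictly below
  \<open>s_seq (Suc N)\<close>, which places \<open>h_star N\<close> in the second branch of
  \<open>rate_H\<close>. For \<open>N = 0\<close> both sides equal 1.\<close>

lemma h_star_gt_threshold:
  assumes "N \<ge> 1"
  shows "h_star N > 1 / (s_seq (Suc N))\<^sup>2"
proof -
  define s where "s = s_seq (Suc N)"
  define p where "p = sqrt (s\<^sup>2 - 2 * real N)"
  have s: "s > 0" and sq: "s\<^sup>2 \<ge> 2 * real N + 1"
    using s_seq_Suc_pos[of N] s_seq_sq_lower[of N] by (auto simp: s_def)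
  have p: "p > 0" using sq by (simp add: p_def)
  have "p < sqrt (s\<^sup>2)"
    unfolding p_def using assms by (intro real_sqrt_less_mono) simp
  then have "p < s" using s by simp
  then have "s * p < s * s" using s by simp
  then have "1 / (s * s) < 1 / (s * p)"
    using s p by (intro divide_strict_left_mono) auto
  then show ?thesis by (simp add: h_star_def power2_eq_square s_def p_def)
qed

text \<open>Completing the square in \<open>a * h + c / h\<close>, with minimizer
  \<open>sqrt (c / a)\<close> and minimum \<open>2 * sqrt (a * c)\<close>. Both can then be read
  off.\<close>

lemma rate_H_above_threshold:
  assumes "h > 0" and "h > 1 / (s_seq (Suc N))\<^sup>2"
  shows "rate_H N h = sqrt (1 - 2 * real N / (s_seq (Suc N))\<^sup>2)
    + ((s_seq (Suc N))\<^sup>2 / 2 - real N) * (h - h_star N)\<^sup>2 / h"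
proof -
  define s where "s = s_seq (Suc N)"
  define p where "p = sqrt (s\<^sup>2 - 2 * real N)"
  have s: "s > 0" and sq: "s\<^sup>2 \<ge> 2 * real N + 1"
    using s_seq_Suc_pos[of N] s_seq_sq_lower[of N] by (auto simp: s_def)
  have p: "p > 0" and p2: "s\<^sup>2 / 2 - real N = p\<^sup>2 / 2"
    using sq by (auto simp: p_def)
  have "p\<^sup>2 / 2 * h + 1 / (2 * s\<^sup>2 * h) = p / s + p\<^sup>2 / 2 * (h - 1 / (s * p))\<^sup>2 / h"
    using s p assms(1) by (simp add: field_simps power2_eq_square)
  then show ?thesis
    using assms(2) unfolding sqrt_rate_eq rate_H_def h_star_def
    by (simp add: p2 flip: s_def p_def)
qed

lemma rate_H_h_star:
  assumes "N \<ge> 1"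
  shows "rate_H N (h_star N) = sqrt (1 - 2 * real N / (s_seq (Suc N))\<^sup>2)"
  using rate_H_above_threshold[OF h_star_pos h_star_gt_threshold[OF assms]] by simp

lemma rate_H_gt_h_star:
  assumes "N \<ge> 1" and "h > 0" and "h \<noteq> h_star N"
  shows "rate_H N (h_star N) < rate_H N h"
proof (cases "h \<le> 1 / (s_seq (Suc N))\<^sup>2")
  case True
  define u where "u = real N / (s_seq (Suc N))\<^sup>2"
  have u: "u > 0" "u \<le> 1"
    using s_seq_Suc_pos[of N] s_seq_sq_lower[of N] assms(1) by (auto simp: u_def)
  \<comment> \<open>The two sides differ by \<open>u\<^sup>2\<close>. Here \<open>1 - u\<close> is
    the value of the decreasing linear branch at the threshold, the least value that branch
    takes.\<close>
  have "1 - 2 * u < (1 - u)\<^sup>2" using u by (simp add: power2_eq_square algebra_simps)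
  then have "sqrt (1 - 2 * u) < 1 - u"
    using u by (simp add: real_less_lsqrt)
  also have "\<dots> \<le> 1 - real N * h"
    using mult_left_mono[OF True, of "real N"] by (simp add: u_def)
  finally show ?thesis
    using True by (simp add: rate_H_h_star[OF assms(1)] u_def) (simp add: rate_H_def)
next
  case False
  have "((s_seq (Suc N))\<^sup>2 / 2 - real N) * (h - h_star N)\<^sup>2 / h > 0"
    using assms s_seq_sq_lower[of N] by (intro divide_pos_pos mult_pos_pos) auto
  then show ?thesis
    using False rate_H_above_threshold[of h N] assms by (simp add: rate_H_h_star)
qed

lemma is_arg_min_iff_unique:
  fixes F :: "'a \<Rightarrow> 'b::order"
  assumes "P a" and "\<And>h. P h \<Longrightarrow> h \<noteq> a \<Longrightarrow> F a < F h"
  shows "is_arg_min F P h \<longleftrightarrow> h = a"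
  using assms unfolding is_arg_min_def by (metis less_asym)

text \<open>The projection is nonexpansive and fixes \<open>w\<close>, so it suffices to expand the
  square for the unprojected step and apply the subgradient inequality at \<open>w\<close>. The
  point \<open>w\<close> is any point of \<open>X\<close>, since the comparison point will
  move.\<close>

lemma projected_subgradient_step:
  fixes X :: "(real^'n) set"
  assumes "closed X" "convex X" "X \<subseteq> D" "w \<in> X"
    and "g \<in> subdifferential D f y" and "norm g \<le> B" and "h \<ge> 0"
  shows "(norm (closest_point X (y - h *\<^sub>R g) - w))\<^sup>2
    \<le> (norm (y - w))\<^sup>2 - 2 * h * (f y - f w) + h\<^sup>2 * B\<^sup>2"
proof -
  have "norm (closest_point X (y - h *\<^sub>R g) - w) \<le> norm (y - h *\<^sub>R g - w)"
    using closest_point_lipschitz[OF assms(2,1), of "y - h *\<^sub>R g" w] assms(4)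
    by (auto simp: closest_point_self dist_norm)
  then have "(norm (closest_point X (y - h *\<^sub>R g) - w))\<^sup>2 \<le> (norm (y - h *\<^sub>R g - w))\<^sup>2"
    by (intro power_mono) auto
  also have "\<dots> = (norm (y - w))\<^sup>2 - 2 * (h * (g \<bullet> (y - w))) + h\<^sup>2 * (norm g)\<^sup>2"
    unfolding power2_norm_eq_inner
    by (simp add: algebra_simps inner_commute power2_eq_square)
  also have "\<dots> \<le> (norm (y - w))\<^sup>2 - 2 * (h * (f y - f w)) + h\<^sup>2 * B\<^sup>2"
  proof -
    have "f w \<ge> f y + g \<bullet> (w - y)"
      using assms(3-5) by (auto simp: subdifferential_def)
    then have "f y - f w \<le> g \<bullet> (y - w)" by (simp add: inner_diff_right)
    then have "h * (f y - f w) \<le> h * (g \<bullet> (y - w))"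
      using assms(7) by (rule mult_left_mono)
    moreover have "h\<^sup>2 * (norm g)\<^sup>2 \<le> h\<^sup>2 * B\<^sup>2"
      using assms(6) by (intro mult_left_mono power_mono) auto
    ultimately show ?thesis by linarith
  qed
  finally show ?thesis by simp
qed

lemma last_iterate_bound:
  fixes X :: "(real^'n) set"
  assumes X: "closed X" "convex X" "X \<subseteq> D" and f: "convex_on D f"
    and ne: "\<forall>z\<in>X. subdifferential D f z \<noteq> {}"
    and B: "bounded_subgradients D f B X" and h: "h > 0"
  shows "\<lbrakk>x 1 \<in> X; z \<in> X;
      \<forall>k\<in>{1..n}. g k \<in> subdifferential D f (x k) \<and>
        x (k + 1) = closest_point X (x k - h *\<^sub>R g k)\<rbrakk>
    \<Longrightarrow> 2 * h * (f (x (n + 1)) - f z)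
      \<le> (norm (x 1 - z))\<^sup>2 / (s_seq (n + 1))\<^sup>2
        + h\<^sup>2 * B\<^sup>2 * ((s_seq (n + 1))\<^sup>2 - 2 * real n)"
\<comment> \<open>The induction hypothesis is applied to the sequences shifted by one and to a new
  comparison point.\<close>
proof (induction n arbitrary: x z g)
  case 0
  \<comment> \<open>No step is left, so \<open>g'\<close> serves for one fictitious step from
    \<open>x 1\<close>; its squared distance to \<open>z\<close> is at least 0, which gives the
    bound.\<close>
  obtain g' where g': "g' \<in> subdifferential D f (x 1)" using ne 0 by blast
  then have "norm g' \<le> B" using B 0 by (auto simp: bounded_subgradients_def)
  from projected_subgradient_step[OF X 0(2) g' this, of h] h
  have "0 \<le> (norm (x 1 - z))\<^sup>2 - 2 * h * (f (x 1) - f z) + h\<^sup>2 * B\<^sup>2"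
    by (smt (verit) zero_le_power2)
  then show ?case by simp
next
  case (Suc n)
  define s where "s = s_seq (Suc n)"
  define t where "t = 1 / s\<^sup>2"
  \<comment> \<open>In the final sum \<open>f w\<close> has weight \<open>1 + t\<close>: 1 from the
    induction hypothesis and \<open>t\<close> from the first step. With this \<open>a\<close>,
    convexity bounds \<open>(1 + t) * f w\<close> by \<open>f z + t * f (x 1)\<close>, and the first
    step cancels the last term.\<close>
  define a where "a = 1 / (1 + t)"
  define w where "w = a *\<^sub>R z + (1 - a) *\<^sub>R x 1"
  have s: "s > 0" using s_seq_Suc_pos by (simp add: s_def)
  then have t: "t > 0" by (simp add: t_def)
  then have a: "0 \<le> a" "a \<le> 1" "(1 + t) * a = 1" by (auto simp: a_def)
  have w: "w \<in> X" unfolding w_def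
    using X(2) Suc.prems a by (intro convexD) auto
  have step1: "g 1 \<in> subdifferential D f (x 1)"
    "x 2 = closest_point X (x 1 - h *\<^sub>R g 1)"
    using bspec[OF Suc.prems(3), of 1] by (simp_all add: numeral_2_eq_2)
  have x2: "x 2 \<in> X"
    unfolding step1(2) using X(1) w by (intro closest_point_in_set) auto
  have "norm (g 1) \<le> B"
    using B Suc.prems(1) step1(1) by (auto simp: bounded_subgradients_def)
  from projected_subgradient_step[OF X w step1(1) this, of h] h
  have proj: "(norm (x 2 - w))\<^sup>2
      \<le> (norm (x 1 - w))\<^sup>2 - 2 * h * (f (x 1) - f w) + h\<^sup>2 * B\<^sup>2"
    by (simp add: step1(2))
  have "2 * h * (f (x (n + 2)) - f w)
      \<le> (norm (x 2 - w))\<^sup>2 / s\<^sup>2 + h\<^sup>2 * B\<^sup>2 * (s\<^sup>2 - 2 * real n)"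
  proof -
    have "\<forall>k\<in>{1..n}. g (Suc k) \<in> subdifferential D f (x (Suc k)) \<and>
        x (Suc (k + 1)) = closest_point X (x (Suc k) - h *\<^sub>R g (Suc k))"
    proof
      fix k assume "k \<in> {1..n}"
      then show "g (Suc k) \<in> subdifferential D f (x (Suc k)) \<and>
          x (Suc (k + 1)) = closest_point X (x (Suc k) - h *\<^sub>R g (Suc k))"
        using bspec[OF Suc.prems(3), of "Suc k"] by simp
    qed
    then show ?thesis
      using Suc.IH[of "\<lambda>k. x (Suc k)" w "\<lambda>k. g (Suc k)"] x2 w
      by (simp add: numeral_2_eq_2 s_def)
  qed
  moreover have "(norm (x 2 - w))\<^sup>2 / s\<^sup>2
      \<le> t * ((norm (x 1 - w))\<^sup>2 - 2 * h * (f (x 1) - f w) + h\<^sup>2 * B\<^sup>2)"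
    using mult_left_mono[OF proj, of t] t by (simp add: t_def)
  moreover have "2 * h * ((1 + t) * f w) \<le> 2 * h * (f z + t * f (x 1))"
  proof -
    have "f w \<le> a * f z + (1 - a) * f (x 1)"
      using convex_onD[OF f, of "1 - a" z "x 1"] a Suc.prems X(3) by (auto simp: w_def)
    then have "(1 + t) * f w \<le> (1 + t) * (a * f z + (1 - a) * f (x 1))"
      using t by (intro mult_left_mono) auto
    also have "\<dots> = ((1 + t) * a) * f z + (1 + t - (1 + t) * a) * f (x 1)"
      by (simp add: algebra_simps)
    finally have "(1 + t) * f w \<le> f z + t * f (x 1)" using a(3) by simp
    then show ?thesis using h by simp
  qed
  moreover have "t * (norm (x 1 - w))\<^sup>2 = (norm (x 1 - z))\<^sup>2 / (s_seq (Suc n + 1))\<^sup>2"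
  proof -
    have "x 1 - w = a *\<^sub>R (x 1 - z)" by (simp add: w_def algebra_simps)
    then have "t * (norm (x 1 - w))\<^sup>2 = (t * a\<^sup>2) * (norm (x 1 - z))\<^sup>2"
      by (simp add: power_mult_distrib)
    moreover have "t * a\<^sup>2 = 1 / (s_seq (Suc n + 1))\<^sup>2"
    proof -
      \<comment> \<open>This is the recursion \<open>s + 1 / s\<close> in factored form; it turns
        \<open>t * a\<^sup>2\<close> into the reciprocal of the next square.\<close>
      have "s_seq (Suc n + 1) = s * (1 + t)"
        using s by (simp add: s_def t_def power2_eq_square field_simps)
      then show ?thesis by (simp add: t_def a_def power_mult_distrib power_divide)
    qed
    ultimately show ?thesis by simp
  qed
  \<comment> \<open>The first step adds \<open>t\<close> to the coefficient of
    \<open>h\<^sup>2 * B\<^sup>2\<close>, and \<open>s\<^sup>2 - 2 * n + t\<close> is the next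
    square minus \<open>2 * (n + 1)\<close>.\<close>
  moreover have "(s_seq (Suc n + 1))\<^sup>2 = s\<^sup>2 + 2 + t"
    using s_seq_Suc_Suc_sq by (simp add: s_def t_def)
  ultimately show ?case by (simp add: algebra_simps)
qed

lemma last_iterate_bound_h_star:
  fixes X :: "(real^'n) set"
  assumes "closed X" "convex X" "X \<subseteq> D" "convex_on D f"
    and "\<forall>z\<in>X. subdifferential D f z \<noteq> {}" and "bounded_subgradients D f B X"
    and "B > 0" "R > 0" and "x 1 \<in> X" "z \<in> X" "norm (x 1 - z) \<le> R"
    and "\<forall>k\<in>{1..N}. g k \<in> subdifferential D f (x k) \<and>
      x (k + 1) = closest_point X (x k - (h_star N * (R / B)) *\<^sub>R g k)"
  shows "f (x (N + 1)) - f z \<le> B * R * sqrt (1 - 2 * real N / (s_seq (N + 1))\<^sup>2)"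
proof -
  define s where "s = s_seq (Suc N)"
  define p where "p = sqrt (s\<^sup>2 - 2 * real N)"
  define h where "h = h_star N * (R / B)"
  have s: "s > 0" and p: "p > 0" and p2: "s\<^sup>2 - 2 * real N = p\<^sup>2"
    using s_seq_Suc_pos[of N] s_seq_sq_lower[of N] by (auto simp: s_def p_def)
  have h: "h > 0" using h_star_pos assms by (simp add: h_def)
  have h_eq: "h = R / (B * s * p)" by (simp add: h_def h_star_def s_def p_def)
  have "2 * h * (f (x (N + 1)) - f z) \<le> (norm (x 1 - z))\<^sup>2 / s\<^sup>2 + h\<^sup>2 * B\<^sup>2 * p\<^sup>2"
    using last_iterate_bound[OF assms(1-6) h, of x z N g, OF assms(9,10) assms(12)[folded h_def]]
    by (simp add: p2 flip: s_def)
  also have "\<dots> \<le> R\<^sup>2 / s\<^sup>2 + h\<^sup>2 * B\<^sup>2 * p\<^sup>2"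
    using assms(11) by (intro add_right_mono divide_right_mono power_mono) auto
  \<comment> \<open>For this \<open>h\<close> both summands equal
    \<open>R\<^sup>2 / s\<^sup>2\<close>.\<close>
  also have "\<dots> = 2 * h * (B * R * (p / s))"
    using s p assms(7,8) by (simp add: h_eq field_simps power2_eq_square)
  finally have "f (x (N + 1)) - f z \<le> B * R * (p / s)"
    by (rule mult_left_le_imp_le) (use h in simp)
  then show ?thesis
    by (simp add: sqrt_rate_eq s_def p_def)
qed

theorem theorem3p6:
  fixes N :: nat and B R :: real
  assumes "N \<ge> 1" and "B > 0" and "R > 0"
  shows "(\<forall>h. is_arg_min (rate_H N) (\<lambda>h. h > 0) h \<longleftrightarrow> h = h_star N)
    \<and> (\<forall>h. is_arg_min (\<lambda>h. B * R * rate_H N h) (\<lambda>h. h > 0) h \<longleftrightarrow> h = h_star N)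
    \<and> (\<forall>(X :: (real^'n) set) (D :: (real^'n) set) (f :: real^'n \<Rightarrow> real)
         (xs :: real^'n) (x :: nat \<Rightarrow> real^'n) (g :: nat \<Rightarrow> real^'n).
         X \<noteq> {} \<and> closed X \<and> convex X \<and>
         convex D \<and> convex_on D f \<and> X \<subseteq> D \<and>
         (\<forall>z\<in>X. subdifferential D f z \<noteq> {}) \<and>
         bounded_subgradients D f B X \<and>
         xs \<in> X \<and> (\<forall>z\<in>X. f xs \<le> f z) \<and>
         x 1 \<in> X \<and> norm (x 1 - xs) \<le> R \<and>
         (\<forall>k\<in>{1..N}. g k \<in> subdifferential D f (x k) \<and>
            x (k + 1) = closest_point X (x k - (h_star N * (R / B)) *\<^sub>R g k))
         \<longrightarrow> f (x (N + 1)) - f xs \<le> B * R * sqrt (1 - 2 * real N / (s_seq (N + 1))\<^sup>2))"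
proof (intro conjI allI impI)
  show "is_arg_min (rate_H N) (\<lambda>h. h > 0) h \<longleftrightarrow> h = h_star N" for h
    using assms h_star_pos rate_H_gt_h_star by (intro is_arg_min_iff_unique) auto
  \<comment> \<open>Scaling by \<open>B * R > 0\<close> preserves the strict inequality, hence the
    unique minimizer.\<close>
  show "is_arg_min (\<lambda>h. B * R * rate_H N h) (\<lambda>h. h > 0) h \<longleftrightarrow> h = h_star N" for h
    using assms h_star_pos rate_H_gt_h_star by (intro is_arg_min_iff_unique) auto
  fix X D :: "(real^'n) set" and f :: "real^'n \<Rightarrow> real" and xs :: "real^'n"
    and x g :: "nat \<Rightarrow> real^'n"
  assume "X \<noteq> {} \<and> closed X \<and> convex X \<and>
         convex D \<and> convex_on D f \<and> X \<subseteq> D \<and>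
         (\<forall>z\<in>X. subdifferential D f z \<noteq> {}) \<and>
         bounded_subgradients D f B X \<and>
         xs \<in> X \<and> (\<forall>z\<in>X. f xs \<le> f z) \<and>
         x 1 \<in> X \<and> norm (x 1 - xs) \<le> R \<and>
         (\<forall>k\<in>{1..N}. g k \<in> subdifferential D f (x k) \<and>
            x (k + 1) = closest_point X (x k - (h_star N * (R / B)) *\<^sub>R g k))"
  then show "f (x (N + 1)) - f xs \<le> B * R * sqrt (1 - 2 * real N / (s_seq (N + 1))\<^sup>2)"
    by (elim conjE) (rule last_iterate_bound_h_star[OF _ _ _ _ _ _ assms(2,3)])
qed

end
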